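(* Let $X=\begin{pmatrix}x&y\\ y&x\end{pmatrix}\in\mathcal{B}^*$. If $\max\{x,y\}>1+\frac{(\min\{x,y\})^2}{4}$, then $X$ is an atom of $M_2(\mathbb{N}_0)^\bullet$.
   Context: $M_2(\mathbb{N}_0)^\bullet$ is the semigroup, under matrix multiplication, of $2\times 2$ matrices with non-negative integer entries and non-zero determinant. Its only units are $I=\begin{pmatrix}1&0\\0&1\end{pmatrix}$ and $J=\begin{pmatrix}0&1\\1&0\end{pmatrix}$. An atom is a non-unit $X\in M_2(\mathbb{N}_0)^\bullet$ such that whenever $X=AB$ with $A,B\in M_2(\mathbb{N}_0)^\bullet$, at least one of $A,B$ is a unit. $\mathcal{B}^*=\left\{\begin{pmatrix}x&y\\ y&x\end{pmatrix}\in M_2(\mathbb{N}_0)^\bullet:\gcd(x,y)=1\right\}$, with the convention $\gcd(n,0)=n$. The displayed inequality is between rational numbers. *)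

theory Defs
  imports "HOL-Analysis.Analysis" "HOL-Algebra.Group"
begin

text \<open>The determinant requires a ring, so the entries are first cast to the integers.\<close>

definition M2N :: "(nat^2^2) monoid" where
  "M2N = \<lparr>carrier = {X. det (map_matrix int X) \<noteq> 0}, mult = (**), one = mat 1\<rparr>"

text \<open>The library predicate \<open>irreducible\<close> is phrased through one-sided divisibility; in a
  noncommutative monoid we use factorizations directly.\<close>

definition atom :: "('a, 'b) monoid_scheme \<Rightarrow> 'a \<Rightarrow> bool" where
  "atom G a \<longleftrightarrow> a \<in> carrier G \<and> a \<notin> Units G \<and>
    (\<forall>b\<in>carrier G. \<forall>c\<in>carrier G. a = b \<otimes>\<^bsub>G\<^esub> c \<longrightarrow> b \<in> Units G \<or> c \<in> Units G)"

definition bisym :: "nat \<Rightarrow> nat \<Rightarrow> nat^2^2" where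
  "bisym x y = vector [vector [x, y], vector [y, x]]"

definition B_star :: "(nat^2^2) set" where
  "B_star = {bisym x y | x y. bisym x y \<in> carrier M2N \<and> gcd x y = 1}"

end

theory Submission
  imports Defs
begin

text \<open>
  Write \<open>X = A B\<close> with \<open>A = (a b; c d)\<close> and \<open>B = (e f; g h)\<close>, so that
  \<open>x = a e + b g = c f + d h\<close> and \<open>y = a f + b h = c e + d g\<close>.

  If all eight entries are positive, then \<open>y\<close> cannot be small compared with \<open>x\<close>.
  A sum of two positive integers exceeds their product by at most \<open>1\<close>, so both \<open>a e \<cdot> b g\<close> and
  \<open>c f \<cdot> d h\<close> are at least \<open>x - 1\<close>. The product of these two numbers is also the
  product of \<open>a f \<cdot> b h\<close> and \<open>c e \<cdot> d g\<close>, so one of the latter is at least \<open>x - 1\<close>, and the inequality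
  between arithmetic and geometric mean gives \<open>y\<^sup>2 \<ge> 4 (x - 1)\<close>. Interchanging the rows of \<open>A\<close>
  interchanges \<open>x\<close> and \<open>y\<close>, so \<open>x\<^sup>2 \<ge> 4 (y - 1)\<close> holds as well. The assumption on \<open>x\<close> and \<open>y\<close>
  contradicts one of these bounds (\<open>square_bound_of_positive_factors\<close>), hence some
  entry of \<open>A\<close> or \<open>B\<close> vanishes.

  If a row of \<open>A\<close> contains a zero, its other entry divides both of the coprime numbers \<open>x\<close> and
  \<open>y\<close>, so it is \<open>1\<close>.
  Because \<open>x \<noteq> y\<close>, this forces \<open>A\<close> to be a permutation matrix (\<open>left_factor_zero_entry\<close>).
  Transposing \<open>X\<close>, which is symmetric, deals with a zero in \<open>B\<close>.
\<close>

definition perm_entries :: "nat \<Rightarrow> nat \<Rightarrow> nat \<Rightarrow> nat \<Rightarrow> bool" where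
  "perm_entries a b c d \<longleftrightarrow>
    (a = 1 \<and> b = 0 \<and> c = 0 \<and> d = 1) \<or> (a = 0 \<and> b = 1 \<and> c = 1 \<and> d = 0)"

text \<open>The four equations expressing that \<open>(a b; c d)\<close> times \<open>(e f; g h)\<close> is \<open>(x y; y x)\<close>. On this
  level, the symmetries of the problem become permutations of the arguments.\<close>

definition factors ::
  "nat \<Rightarrow> nat \<Rightarrow> nat \<Rightarrow> nat \<Rightarrow> nat \<Rightarrow> nat \<Rightarrow> nat \<Rightarrow> nat \<Rightarrow> nat \<Rightarrow> nat \<Rightarrow> bool" where
  "factors a b c d e f g h x y \<longleftrightarrow>
    a * e + b * g = x \<and> a * f + b * h = y \<and> c * e + d * g = y \<and> c * f + d * h = x"

lemma factors_swap_middle: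
  "factors a b c d e f g h x y \<Longrightarrow> factors b a d c g h e f x y"
  by (simp add: factors_def add.commute)

lemma factors_swap_rows:
  "factors a b c d e f g h x y \<Longrightarrow> factors c d a b e f g h y x"
  by (simp add: factors_def)

lemma factors_transpose:
  "factors a b c d e f g h x y \<Longrightarrow> factors e g f h a c b d x y"
  by (simp add: factors_def mult.commute)

section \<open>Factorizations with positive entries\<close>

lemma add_le_Suc_mult:
  fixes m n :: nat
  assumes "0 < m" "0 < n"
  shows "m + n \<le> m * n + 1"
proof -
  obtain i j where "m = Suc i" "n = Suc j"
    using assms gr0_implies_Suc by blast
  then show ?thesis by simp
qed

lemma four_mult_le_power2_add:
  fixes m n :: nat
  shows "4 * (m * n) \<le> (m + n)\<^sup>2"
proof -
  have "0 \<le> (int m - int n)\<^sup>2" by simp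
  then have "int (4 * (m * n)) \<le> int ((m + n)\<^sup>2)"
    by (simp add: power2_eq_square algebra_simps)
  then show ?thesis by (simp only: of_nat_le_iff)
qed

lemma square_bound_of_positive_factors:
  assumes F: "factors a b c d e f g h x y"
    and pos: "0 < a" "0 < b" "0 < c" "0 < d" "0 < e" "0 < f" "0 < g" "0 < h"
  shows "4 * x \<le> 4 + y\<^sup>2"
proof (rule ccontr)
  assume small: "\<not> 4 * x \<le> 4 + y\<^sup>2"
  have x_le: "x - 1 \<le> (a * e) * (b * g)" "x - 1 \<le> (c * f) * (d * h)"
    using add_le_Suc_mult[of "a * e" "b * g"] add_le_Suc_mult[of "c * f" "d * h"] pos F
    by (simp_all add: factors_def)
  have "4 * ((a * f) * (b * h)) \<le> y\<^sup>2" "4 * ((c * e) * (d * g)) \<le> y\<^sup>2"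
    using four_mult_le_power2_add[of "a * f" "b * h"] four_mult_le_power2_add[of "c * e" "d * g"] F
    by (simp_all only: factors_def)
  then have "(a * f) * (b * h) < x - 1" "(c * e) * (d * g) < x - 1"
    using small by linarith+
  then have "((a * f) * (b * h)) * ((c * e) * (d * g)) < (x - 1) * (x - 1)"
    by (intro mult_strict_mono) auto
  also have "\<dots> \<le> ((a * e) * (b * g)) * ((c * f) * (d * h))"
    using x_le by (rule mult_mono) auto
  also have "\<dots> = ((a * f) * (b * h)) * ((c * e) * (d * g))"
    by (simp only: ac_simps)
  finally show False by simp
qed

section \<open>Factorizations with a zero entry\<close>

lemma eq_1_of_mult_coprime:
  fixes k m n :: nat
  assumes "coprime (k * m) (k * n)"
  shows "k = 1"
  using assms by (metis coprime_common_divisor_nat dvd_triv_left)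

text \<open>If \<open>b = 0\<close>, then \<open>(x, y) = a (e, f)\<close>, so \<open>a = 1\<close> and \<open>B\<close> has first row \<open>(x, y)\<close>. A nonzero \<open>c\<close>
  would make the second row \<open>(y, x)\<close> of the product dominate \<open>(x, y)\<close> entrywise, that is, \<open>x = y\<close>.\<close>

lemma left_factor_zero_upper_right:
  assumes F: "factors a 0 c d e f g h x y" and "coprime x y" "x \<noteq> y"
  shows "perm_entries a 0 c d"
proof -
  have a: "a = 1"
    using F \<open>coprime x y\<close> eq_1_of_mult_coprime[of a e f] by (auto simp: factors_def)
  then have rows: "c * x + d * g = y" "c * y + d * h = x"
    using F by (auto simp: factors_def)
  have c: "c = 0"
  proof (rule ccontr)
    assume "c \<noteq> 0"
    then have "x \<le> c * x" "y \<le> c * y" by simp_all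
    then show False using rows \<open>x \<noteq> y\<close> by linarith
  qed
  have "d = 1"
    using rows \<open>coprime x y\<close> eq_1_of_mult_coprime[of d g h] by (auto simp: c coprime_commute)
  with a c show ?thesis by (simp add: perm_entries_def)
qed

lemma left_factor_zero_entry:
  assumes F: "factors a b c d e f g h x y" and "coprime x y" "x \<noteq> y"
    and zero: "a = 0 \<or> b = 0 \<or> c = 0 \<or> d = 0"
  shows "perm_entries a b c d"
proof -
  note up = left_factor_zero_upper_right
  have yx: "coprime y x" "y \<noteq> x"
    using assms(2,3) by (simp_all add: coprime_commute)
  from zero consider "b = 0" | "a = 0" | "d = 0" | "c = 0" by blast
  then show ?thesis
  proof cases
    case 1
    then show ?thesis using up[of a c d] F assms(2,3) by blast
  next
    case 2
    then have "perm_entries b a d c"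
      using up[of b d c] factors_swap_middle[OF F] assms(2,3) by blast
    then show ?thesis by (auto simp: perm_entries_def)
  next
    case 3
    then have "perm_entries c d a b"
      using up[of c a b] factors_swap_rows[OF F] yx by blast
    then show ?thesis by (auto simp: perm_entries_def)
  next
    case 4
    then have "perm_entries d c b a"
      using up[of d b a] factors_swap_middle[OF factors_swap_rows[OF F]] yx by blast
    then show ?thesis by (auto simp: perm_entries_def)
  qed
qed

lemma factor_is_perm:
  assumes F: "factors a b c d e f g h x y" and cop: "coprime x y" and ne: "x \<noteq> y"
    and big: "4 + y\<^sup>2 < 4 * x \<or> 4 + x\<^sup>2 < 4 * y"
  shows "perm_entries a b c d \<or> perm_entries e f g h"
proof -
  have "\<not> (0 < a \<and> 0 < b \<and> 0 < c \<and> 0 < d \<and> 0 < e \<and> 0 < f \<and> 0 < g \<and> 0 < h)"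
  proof (intro notI, elim conjE)
    assume pos: "0 < a" "0 < b" "0 < c" "0 < d" "0 < e" "0 < f" "0 < g" "0 < h"
    have "4 * x \<le> 4 + y\<^sup>2"
      using F pos by (rule square_bound_of_positive_factors)
    moreover have "4 * y \<le> 4 + x\<^sup>2"
      using factors_swap_rows[OF F] pos(3,4,1,2,5-8) by (rule square_bound_of_positive_factors)
    ultimately show False using big by linarith
  qed
  then consider "a = 0 \<or> b = 0 \<or> c = 0 \<or> d = 0" | "e = 0 \<or> g = 0 \<or> f = 0 \<or> h = 0"
    by auto
  then show ?thesis
  proof cases
    case 1
    then show ?thesis using left_factor_zero_entry[OF F cop ne] by blast
  next
    case 2
    then have "perm_entries e g f h"
      by (rule left_factor_zero_entry[OF factors_transpose[OF F] cop ne])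
    then show ?thesis by (auto simp: perm_entries_def)
  qed
qed

section \<open>Matrices\<close>

lemma matrix_mult_2:
  fixes A B :: "nat^2^2"
  shows "(A ** B) $ i $ j = A $ i $ 1 * B $ 1 $ j + A $ i $ 2 * B $ 2 $ j"
  by (simp add: matrix_matrix_mult_def sum_2)

lemma bisym_nth:
  "bisym x y $ 1 $ 1 = x" "bisym x y $ 1 $ 2 = y"
  "bisym x y $ 2 $ 1 = y" "bisym x y $ 2 $ 2 = x"
  by (simp_all add: bisym_def)

lemma factors_of_matrix_product:
  fixes A B :: "nat^2^2"
  assumes "bisym x y = A ** B"
  shows "factors (A$1$1) (A$1$2) (A$2$1) (A$2$2) (B$1$1) (B$1$2) (B$2$1) (B$2$2) x y"
  unfolding factors_def matrix_mult_2[symmetric] assms[symmetric] by (simp add: bisym_nth)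

lemma bisym_carrier_neq:
  assumes "bisym x y \<in> carrier M2N"
  shows "x \<noteq> y"
  using assms by (auto simp: M2N_def det_2 map_matrix_def bisym_nth)

lemma perm_in_Units:
  assumes "A \<in> carrier M2N" and "perm_entries (A$1$1) (A$1$2) (A$2$1) (A$2$2)"
  shows "A \<in> Units M2N"
proof -
  have "A ** A = mat 1"
    using assms(2) by (auto simp: vec_eq_iff forall_2 matrix_mult_2 mat_def perm_entries_def)
  with assms(1) show ?thesis by (auto simp: Units_def M2N_def)
qed

text \<open>If the entries of \<open>X\<close> are positive, the zero in the second column of \<open>X B = I\<close> forces the whole
  second column of \<open>B\<close> to vanish.\<close>

lemma bisym_notin_Units:
  assumes "0 < x" "0 < y"
  shows "bisym x y \<notin> Units M2N"
proof
  assume "bisym x y \<in> Units M2N"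
  then obtain B where B: "bisym x y ** B = mat 1"
    by (auto simp: Units_def M2N_def)
  have "x * B$1$2 + y * B$2$2 = 0"
    using matrix_mult_2[of "bisym x y" B 1 2] by (simp add: B bisym_nth mat_def)
  moreover have "y * B$1$2 + x * B$2$2 = 1"
    using matrix_mult_2[of "bisym x y" B 2 2] by (simp add: B bisym_nth mat_def)
  ultimately show False using assms by simp
qed

lemma B_star_bisymD:
  assumes "bisym x y \<in> B_star"
  shows "bisym x y \<in> carrier M2N" "coprime x y"
proof -
  obtain x' y' where eq: "bisym x y = bisym x' y'"
    and X: "bisym x' y' \<in> carrier M2N" "gcd x' y' = 1"
    using assms by (auto simp: B_star_def)
  have "x = x'" "y = y'"
    using eq by (metis bisym_nth(1), metis bisym_nth(2))
  with X show "bisym x y \<in> carrier M2N" "coprime x y"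
    by (simp_all add: coprime_iff_gcd_eq_1)
qed

theorem corollary6p4:
  fixes x y :: nat
  assumes "bisym x y \<in> B_star"
    and "rat_of_nat (max x y) > 1 + (rat_of_nat (min x y))\<^sup>2 / 4"
  shows "atom M2N (bisym x y)"
proof -
  note X = B_star_bisymD[OF assms(1)]
  note ne = bisym_carrier_neq[OF X(1)]
  have "rat_of_nat (4 + (min x y)\<^sup>2) < rat_of_nat (4 * max x y)"
    using assms(2) by (simp add: field_simps)
  then have bound: "4 + (min x y)\<^sup>2 < 4 * max x y"
    by (simp only: of_nat_less_iff)
  then have big: "4 + y\<^sup>2 < 4 * x \<or> 4 + x\<^sup>2 < 4 * y"
    by (auto simp: min_def max_def split: if_splits)
  \<comment> \<open>If one entry is zero, coprimality makes the other \<open>1\<close>, and the strict bound fails.\<close>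
  have "0 < x" "0 < y"
    using X(2) bound by (auto intro!: gr0I)
  then have "bisym x y \<notin> Units M2N" by (rule bisym_notin_Units)
  moreover have "A \<in> Units M2N \<or> B \<in> Units M2N"
    if "A \<in> carrier M2N" "B \<in> carrier M2N" "bisym x y = A ** B" for A B
    using factor_is_perm[OF factors_of_matrix_product[OF that(3)] X(2) ne big]
      perm_in_Units that(1,2) by blast
  ultimately show ?thesis
    using X(1) by (auto simp: atom_def M2N_def)
qed

end
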